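(* Let $(G,\tau,\oplus)$ be a strongly topological gyrogroup which is feathered. Then the space $(G,\tau)$ is a $D$-space.
   Context: A gyrogroup is a nonempty set $G$ with a binary operation $\oplus$ such that: (G1) there is a unique identity element $0\in G$ with $0\oplus a=a=a\oplus 0$ for all $a\in G$; (G2) for each $x\in G$ there is a unique inverse $\ominus x\in G$ with $\ominus x\oplus x=0=x\oplus(\ominus x)$; (G3) for all $x,y\in G$ there is an automorphism $gyr[x,y]$ of $(G,\oplus)$ (a bijective homomorphism of $(G,\oplus)$ onto itself) such that $x\oplus(y\oplus z)=(x\oplus y)\oplus gyr[x,y](z)$ for all $z\in G$; (G4) $gyr[x\oplus y,y]=gyr[x,y]$ for all $x,y\in G$. A topological gyrogroup $(G,\tau,\oplus)$ is a gyrogroup $(G,\oplus)$ with a topology $\tau$ such that $\oplus:G\times G\to G$ is jointly continuous and $x\mapsto\ominus x$ is continuous. All topological gyrogroups are assumed to be $T_1$ spaces. A topological gyrogroup $G$ is a strongly topological gyrogroup if there is a neighborhood base $\mathscr U$ of $0$ such that $gyr[x,y](U)=U$ for every $U\in\mathscr U$ and all $x,y\in G$. The character of a space $X$ at a set $F\subset X$ is the smallest cardinality of a base for $X$ at $F$, i.e. of a family $\gamma$ of open sets, each containing $F$, such that every open set containing $F$ contains some member of $\gamma$. A topological gyrogroup $G$ is feathered if it contains a non-empty compact set $K$ of countable character in $G$. A space $X$ is a $D$-space if for every assignment $x\mapsto O_x$ of an open neighborhood $O_x$ to each point $x\in X$ there is a closed discrete subset $D\subset X$ such that $X=\bigcup_{x\in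 D}O_x$. *)

theory Defs
  imports "HOL-Analysis.Analysis" "HOL-Library.Countable_Set_Type"
begin

unbundle cardinal_syntax

text \<open>
  The zero, the inverse and the gyrations are determined on \<open>G\<close> by the operation; they are
  locale parameters rather than descriptions. All operations are total functions, whose values
  outside \<open>G\<close> are irrelevant, so (G4) is stated pointwise on \<open>G\<close>.
\<close>

locale gyrogroup =
  fixes G :: "'a set"
    and gadd :: "'a \<Rightarrow> 'a \<Rightarrow> 'a"  (infixl "\<oplus>" 65)
    and gzero :: 'a  ("\<zero>")
    and gneg :: "'a \<Rightarrow> 'a"  ("\<ominus> _" [81] 80)
    and gyr :: "'a \<Rightarrow> 'a \<Rightarrow> 'a \<Rightarrow> 'a"
  assumes add_closed: "\<lbrakk>x \<in> G; y \<in> G\<rbrakk> \<Longrightarrow> x \<oplus> y \<in> G"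
    and zero_closed: "\<zero> \<in> G"
    and zero_left: "a \<in> G \<Longrightarrow> \<zero> \<oplus> a = a"
    and zero_right: "a \<in> G \<Longrightarrow> a \<oplus> \<zero> = a"
    and zero_unique: "\<lbrakk>e \<in> G; \<forall>a\<in>G. e \<oplus> a = a \<and> a \<oplus> e = a\<rbrakk> \<Longrightarrow> e = \<zero>"
    and neg_closed: "x \<in> G \<Longrightarrow> \<ominus> x \<in> G"
    and neg_left: "x \<in> G \<Longrightarrow> \<ominus> x \<oplus> x = \<zero>"
    and neg_right: "x \<in> G \<Longrightarrow> x \<oplus> (\<ominus> x) = \<zero>"
    and neg_unique: "\<lbrakk>x \<in> G; y \<in> G; y \<oplus> x = \<zero>; x \<oplus> y = \<zero>\<rbrakk> \<Longrightarrow> y = \<ominus> x"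
    and gyr_bij: "\<lbrakk>x \<in> G; y \<in> G\<rbrakk> \<Longrightarrow> bij_betw (gyr x y) G G"
    and gyr_hom: "\<lbrakk>x \<in> G; y \<in> G; a \<in> G; b \<in> G\<rbrakk> \<Longrightarrow>
                    gyr x y (a \<oplus> b) = gyr x y a \<oplus> gyr x y b"
    and gyr_assoc: "\<lbrakk>x \<in> G; y \<in> G; z \<in> G\<rbrakk> \<Longrightarrow> x \<oplus> (y \<oplus> z) = (x \<oplus> y) \<oplus> gyr x y z"
    and gyr_loop: "\<lbrakk>x \<in> G; y \<in> G; z \<in> G\<rbrakk> \<Longrightarrow> gyr (x \<oplus> y) y z = gyr x y z"

locale topological_gyrogroup = gyrogroup G gadd gzero gneg gyr
  for G :: "'a set" and T :: "'a topology"
    and gadd (infixl "\<oplus>" 65) and gzero ("\<zero>") and gneg ("\<ominus> _" [81] 80) and gyr +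
  assumes topspace_eq: "topspace T = G"
    and T1: "t1_space T"
    and add_continuous: "continuous_map (prod_topology T T) T (\<lambda>(x, y). x \<oplus> y)"
    and neg_continuous: "continuous_map T T (\<lambda>x. \<ominus> x)"

text \<open>Neighbourhoods, and hence the members of a neighbourhood base, need not be open.\<close>

definition nhd_base :: "'a topology \<Rightarrow> 'a \<Rightarrow> 'a set set \<Rightarrow> bool" where
  "nhd_base X a \<U> \<longleftrightarrow>
     (\<forall>U\<in>\<U>. U \<subseteq> topspace X \<and> (\<exists>V. openin X V \<and> a \<in> V \<and> V \<subseteq> U)) \<and>
     (\<forall>W. openin X W \<and> a \<in> W \<longrightarrow> (\<exists>U\<in>\<U>. U \<subseteq> W))"

locale strongly_topological_gyrogroup = topological_gyrogroup G T gadd gzero gneg gyr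
  for G :: "'a set" and T :: "'a topology"
    and gadd (infixl "\<oplus>" 65) and gzero ("\<zero>") and gneg ("\<ominus> _" [81] 80) and gyr +
  assumes gyr_invariant_base:
    "\<exists>\<U>. nhd_base T \<zero> \<U> \<and> (\<forall>U\<in>\<U>. \<forall>x\<in>G. \<forall>y\<in>G. gyr x y ` U = U)"

definition base_at :: "'a topology \<Rightarrow> 'a set \<Rightarrow> 'a set set \<Rightarrow> bool" where
  "base_at X F \<gamma> \<longleftrightarrow>
     (\<forall>U\<in>\<gamma>. openin X U \<and> F \<subseteq> U) \<and>
     (\<forall>W. openin X W \<and> F \<subseteq> W \<longrightarrow> (\<exists>U\<in>\<gamma>. U \<subseteq> W))"

text \<open>
  The character is a cardinal of the BNF cardinal library, represented by a well-order on a base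
  of least cardinality; it is only meaningful up to \<open>=o\<close>.
\<close>

definition character_at :: "'a topology \<Rightarrow> 'a set \<Rightarrow> 'a set rel" where
  "character_at X F =
     |SOME \<gamma>. base_at X F \<gamma> \<and> (\<forall>\<gamma>'. base_at X F \<gamma>' \<longrightarrow> |\<gamma>| \<le>o |\<gamma>'| )|"

definition feathered :: "'a topology \<Rightarrow> bool" where
  "feathered X \<longleftrightarrow> (\<exists>K. K \<noteq> {} \<and> compactin X K \<and> character_at X K \<le>o natLeq)"

definition D_space :: "'a topology \<Rightarrow> bool" where
  "D_space X \<longleftrightarrow>
     (\<forall>N. (\<forall>x\<in>topspace X. openin X (N x) \<and> x \<in> N x) \<longrightarrow>
        (\<exists>D. closedin X D \<and> subtopology X D = discrete_topology D \<and>
             topspace X = (\<Union>x\<in>D. N x)))"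

lemma character_at_least:
  obtains \<gamma> where "base_at X F \<gamma>" "character_at X F = |\<gamma>|"
    "\<And>\<gamma>'. base_at X F \<gamma>' \<Longrightarrow> |\<gamma>| \<le>o |\<gamma>'|"
proof -
  let ?R = "card_of ` {\<gamma>. base_at X F \<gamma>}"
  have "base_at X F {U. openin X U \<and> F \<subseteq> U}"
    by (auto simp: base_at_def)
  then have "?R \<noteq> {}" by blast
  moreover have "\<forall>r\<in>?R. Well_order r" using card_of_Well_order by blast
  ultimately obtain r where "r \<in> ?R" "\<forall>r'\<in>?R. r \<le>o r'"
    using exists_minim_Well_order[of ?R] by blast
  then have "\<exists>\<gamma>. base_at X F \<gamma> \<and> (\<forall>\<gamma>'. base_at X F \<gamma>' \<longrightarrow> |\<gamma>| \<le>o |\<gamma>'| )"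
    by blast
  from someI_ex[OF this] show ?thesis
    using that unfolding character_at_def by blast
qed

lemma character_at_countable_iff:
  "character_at X F \<le>o natLeq \<longleftrightarrow> (\<exists>\<gamma>. base_at X F \<gamma> \<and> countable \<gamma>)"
  by (metis character_at_least countable_card_le_natLeq ordLeq_transitive)

end

theory Submission
  imports Defs
begin

text \<open>
  A countable base at a compact set \<open>K\<close> containing \<open>\<zero>\<close> yields gyration-invariant symmetric
  neighbourhoods \<open>U n\<close> of \<open>\<zero>\<close> with \<open>U (Suc n) \<oplus> U (Suc n) \<subseteq> U n\<close>, shrinking to a compact
  set \<open>H \<subseteq> K\<close> at which they form a base. Since gyrations preserve \<open>U n\<close>, the relations
  \<open>\<ominus> x \<oplus> y \<in> U n\<close> form a countable base of a uniformity whose classes are the compact sets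
  \<open>x \<oplus> H\<close>: in effect \<open>G\<close> is a perfect preimage of a metrizable space. The usual argument for
  metrizable spaces then applies: cover each class by finitely many of the given neighbourhoods,
  and choose the classes successively as maximal separated families among the points not yet
  covered.
\<close>

section \<open>Maximal separated families and closed discrete sets\<close>

text \<open>Zorn's lemma applies because the union of a chain of pairwise related sets is again
  pairwise related. \<open>R\<close> need not be symmetric, so maximality only yields a failure in
  one of the two directions.\<close>

lemma maximal_pairwise_subset:
  obtains M where "M \<subseteq> A" "pairwise R M"
    "\<And>x. x \<in> A \<Longrightarrow> x \<in> M \<or> (\<exists>p\<in>M. \<not> R x p \<or> \<not> R p x)"
proof -
  let ?\<A> = "{M. M \<subseteq> A \<and> pairwise R M}"
  have "\<exists>M\<in>?\<A>. \<forall>X\<in>?\<A>. M \<subseteq> X \<longrightarrow> X = M"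
  proof (rule subset_Zorn_nonempty)
    show "?\<A> \<noteq> {}" by (force simp: pairwise_def)
  next
    fix C assume "C \<noteq> {}" "subset.chain ?\<A> C"
    then have sub: "C \<subseteq> ?\<A>" and lin: "\<And>P Q. P \<in> C \<Longrightarrow> Q \<in> C \<Longrightarrow> P \<subseteq> Q \<or> Q \<subseteq> P"
      by (auto simp: subset_chain_def)
    have "pairwise R (\<Union>C)"
      unfolding pairwise_def
    proof (intro ballI impI)
      fix x y assume "x \<in> \<Union>C" "y \<in> \<Union>C" "x \<noteq> y"
      then obtain P where "P \<in> C" "x \<in> P" "y \<in> P" using lin by blast
      then show "R x y" using sub \<open>x \<noteq> y\<close> by (auto dest: pairwiseD)
    qed
    with sub show "\<Union>C \<in> ?\<A>" by auto
  qed
  then obtain M where "M \<in> ?\<A>" and max': "\<forall>X\<in>?\<A>. M \<subseteq> X \<longrightarrow> X = M" ..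
  then have M: "M \<subseteq> A" "pairwise R M" by auto
  have max: "X = M" if "X \<subseteq> A" "pairwise R X" "M \<subseteq> X" for X
    using max' that by simp
  show ?thesis
  proof (rule that[OF M])
    fix x assume "x \<in> A"
    show "x \<in> M \<or> (\<exists>p\<in>M. \<not> R x p \<or> \<not> R p x)"
      using max[of "insert x M"] M \<open>x \<in> A\<close> by (auto simp: pairwise_insert)
  qed
qed

text \<open>In a T1 space the finitely many points of \<open>D \<inter> W\<close> other than
  \<open>x\<close> can be removed from \<open>W\<close>, leaving a neighbourhood of \<open>x\<close>
  that contains no other point of \<open>D\<close>. Thus \<open>D\<close> has no accumulation
  points, which gives closedness and discreteness at once.\<close>

lemma locally_finite_points_closed_discrete:
  assumes "t1_space X" "D \<subseteq> topspace X"
    and fin: "\<And>x. x \<in> topspace X \<Longrightarrow> \<exists>W. openin X W \<and> x \<in> W \<and> finite (D \<inter> W)"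
  shows "closedin X D" "subtopology X D = discrete_topology D"
proof -
  have "X derived_set_of D = {}"
  proof (rule ccontr)
    assume "X derived_set_of D \<noteq> {}"
    then obtain x where "x \<in> X derived_set_of D" by blast
    then have x: "x \<in> topspace X"
      and acc: "\<And>T. x \<in> T \<Longrightarrow> openin X T \<Longrightarrow> \<exists>y. y \<noteq> x \<and> y \<in> D \<and> y \<in> T"
      by (auto simp: in_derived_set_of)
    obtain W where W: "openin X W" "x \<in> W" "finite (D \<inter> W)" using fin x by blast
    have "closedin X (D \<inter> W - {x})"
      using assms(1,2) W(3) unfolding t1_space_closedin_finite by (meson Diff_subset finite_Diff inf_le1 order_trans)
    then have "openin X (W - (D \<inter> W - {x}))" using W(1) by (rule openin_diff[rotated])
    then show False using acc[of "W - (D \<inter> W - {x})"] W(2) by blast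
  qed
  then show "closedin X D" "subtopology X D = discrete_topology D"
    using assms(2) by (auto simp: closedin_contains_derived_set subtopology_eq_discrete_topology_eq)
qed

section \<open>A criterion for D-spaces by entourages with compact classes\<close>

text \<open>Stage \<open>n\<close> picks a maximal family \<open>D n\<close> of
  \<open>V (Suc n)\<close>-separated centres among the points not yet absorbed. Each centre
  \<open>p\<close> contributes a finite set \<open>F p\<close> from its class, and the union of all
  \<open>F p\<close> is locally finite: near a given point no late stage contributes, and each
  earlier one contributes through at most one centre.\<close>

lemma D_space_if_perfect_entourages:
  fixes X :: "'a topology" and V :: "nat \<Rightarrow> 'a \<Rightarrow> 'a set"
  defines "C \<equiv> \<lambda>x. \<Inter>n. V n x"
  assumes t1: "t1_space X"
    and refl: "\<And>n x. x \<in> topspace X \<Longrightarrow> x \<in> V n x"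
    and sub: "\<And>n x. x \<in> topspace X \<Longrightarrow> V n x \<subseteq> topspace X"
    and sym: "\<And>n x y. \<lbrakk>x \<in> topspace X; y \<in> V n x\<rbrakk> \<Longrightarrow> x \<in> V n y"
    and comp: "\<And>n x y z. \<lbrakk>x \<in> topspace X; y \<in> V (Suc n) x; z \<in> V (Suc n) y\<rbrakk> \<Longrightarrow> z \<in> V n x"
    and nbhd: "\<And>n x. x \<in> topspace X \<Longrightarrow> \<exists>W. openin X W \<and> x \<in> W \<and> W \<subseteq> V n x"
    and cpt: "\<And>x. x \<in> topspace X \<Longrightarrow> compactin X (C x)"
    and base: "\<And>x W. \<lbrakk>x \<in> topspace X; openin X W; C x \<subseteq> W\<rbrakk> \<Longrightarrow> \<exists>n. V n x \<subseteq> W"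
  shows "D_space X"
  unfolding D_space_def
proof (intro allI impI)
  fix N assume N: "\<forall>x\<in>topspace X. openin X (N x) \<and> x \<in> N x"
  have V_Suc: "V (Suc n) x \<subseteq> V n x" if "x \<in> topspace X" for n x
    using comp refl sub that by blast
  then have V_mono: "V m x \<subseteq> V n x" if "x \<in> topspace X" "n \<le> m" for n m x
    using lift_Suc_antimono_le[of "\<lambda>n. V n x"] that by blast
  \<comment> \<open>A finite subcover of the compact class \<open>C x\<close> has an open union,
    which therefore contains some \<open>V n x\<close>. These choices become \<open>F x\<close> and
    the scale \<open>k x\<close>.\<close>
  have "\<exists>F n. finite F \<and> F \<subseteq> C x \<and> V n x \<subseteq> (\<Union>y\<in>F. N y)" if x: "x \<in> topspace X" for x
  proof -
    have CX: "C x \<subseteq> topspace X" using cpt[OF x] compactin_subset_topspace by blast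
    obtain F where F: "finite F" "F \<subseteq> C x" "C x \<subseteq> (\<Union>y\<in>F. N y)"
    proof -
      have "\<forall>U\<in>N ` C x. openin X U" "C x \<subseteq> \<Union>(N ` C x)" using N CX by auto
      then obtain \<F> where "finite \<F>" "\<F> \<subseteq> N ` C x" "C x \<subseteq> \<Union>\<F>"
        using cpt[OF x] unfolding compactin_def by meson
      then show ?thesis using that by (metis finite_subset_image)
    qed
    moreover have "openin X (\<Union>y\<in>F. N y)" using N F CX by blast
    ultimately show ?thesis using base[OF x] by meson
  qed
  then obtain F k where F: "\<And>x. x \<in> topspace X \<Longrightarrow> finite (F x) \<and> F x \<subseteq> C x \<and> V (k x) x \<subseteq> (\<Union>y\<in>F x. N y)"
    by metis
  define net where "net n A M \<longleftrightarrow> M \<subseteq> A \<and> pairwise (\<lambda>p q. q \<notin> V (Suc n) p) M \<and>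
      (\<forall>x\<in>A. \<exists>p\<in>M. x \<in> V (Suc n) p)" for n A M
  have ex_net: "\<exists>M. net n A M" if "A \<subseteq> topspace X" for n A
  proof -
    obtain M where M: "M \<subseteq> A" "pairwise (\<lambda>p q. q \<notin> V (Suc n) p) M"
      "\<And>x. x \<in> A \<Longrightarrow> x \<in> M \<or> (\<exists>p\<in>M. \<not> p \<notin> V (Suc n) x \<or> \<not> x \<notin> V (Suc n) p)"
      using maximal_pairwise_subset[of A "\<lambda>p q. q \<notin> V (Suc n) p"] by blast
    have "\<exists>p\<in>M. x \<in> V (Suc n) p" if "x \<in> A" for x
      using M(3)[OF that] refl sym that \<open>A \<subseteq> topspace X\<close> by blast
    with M show ?thesis unfolding net_def by blast
  qed
  define sel where "sel n A = (SOME M. net n A M)" for n A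
  have sel: "net n A (sel n A)" if "A \<subseteq> topspace X" for n A
    unfolding sel_def using ex_net[OF that] by (rule someI_ex)
  \<comment> \<open>Deleting the points having a whole \<open>V m x\<close> inside \<open>V n p\<close>, rather than all points of \<open>V n p\<close>,
    makes the deleted set open with respect to the entourages.\<close>
  define I where "I n M = {x \<in> topspace X. \<exists>p\<in>M. \<exists>m. V m x \<subseteq> V n p}" for n M
  \<comment> \<open>\<open>B n\<close> is what the stages before \<open>n\<close> have absorbed.
    Stage \<open>n\<close> admits only points with \<open>k x \<le> n\<close>, so that
    \<open>V n p \<subseteq> V (k p) p\<close> is covered for each centre \<open>p\<close>; every
    \<open>x\<close> becomes eligible at stage \<open>k x\<close> at the latest.\<close>
  define B where "B = rec_nat {} (\<lambda>n B. B \<union> I n (sel n ({x \<in> topspace X. k x \<le> n} - B)))"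
  define D where "D n = sel n ({x \<in> topspace X. k x \<le> n} - B n)" for n
  have B_Suc: "B (Suc n) = B n \<union> I n (D n)" for n by (simp add: B_def D_def)
  have B_mono: "I j (D j) \<subseteq> B n" if "j < n" for j n
    using that by (induction n) (auto simp: B_Suc less_Suc_eq)
  have B_cover: "\<exists>j<n. x \<in> I j (D j)" if "x \<in> B n" for n x
    using that by (induction n) (auto simp: B_Suc less_Suc_eq, simp add: B_def)
  have D_sub: "D n \<subseteq> {x \<in> topspace X. k x \<le> n} - B n"
    and D_sep: "pairwise (\<lambda>p q. q \<notin> V (Suc n) p) (D n)"
    and D_max: "\<And>x. x \<in> topspace X \<Longrightarrow> k x \<le> n \<Longrightarrow> x \<notin> B n \<Longrightarrow> \<exists>p\<in>D n. x \<in> V (Suc n) p" for n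
    using sel[of "{x \<in> topspace X. k x \<le> n} - B n" n] unfolding D_def net_def by auto
  have D_X: "D n \<subseteq> topspace X" for n using D_sub by blast
  have cover: "\<exists>j. x \<in> I j (D j)" if x: "x \<in> topspace X" for x
  proof (cases "x \<in> B (k x)")
    case False
    then obtain p where p: "p \<in> D (k x)" "x \<in> V (Suc (k x)) p" using D_max[OF x, of "k x"] by auto
    \<comment> \<open>Separation uses the finer scale \<open>Suc n\<close> so that one composition
      puts a whole entourage neighbourhood of \<open>x\<close> inside \<open>V n p\<close>, as
      membership in \<open>I\<close> demands.\<close>
    then have "V (Suc (k x)) x \<subseteq> V (k x) p" using comp D_X by blast
    with p x show ?thesis by (auto simp: I_def)
  qed (use B_cover in blast)
  define E where "E = (\<Union>n. \<Union>p\<in>D n. F p)"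
  have C_X: "C x \<subseteq> topspace X" if "x \<in> topspace X" for x using cpt[OF that] compactin_subset_topspace by blast
  have E_X: "E \<subseteq> topspace X" unfolding E_def using F D_X C_X by blast
  have "\<exists>W. openin X W \<and> x \<in> W \<and> finite (E \<inter> W)" if x: "x \<in> topspace X" for x
  proof -
    obtain j p m where p: "p \<in> D j" "V m x \<subseteq> V j p" using cover[OF x] by (auto simp: I_def)
    \<comment> \<open>The scale of \<open>W\<close> leaves room for three compositions: one passes
      from a point of \<open>F q\<close> to its centre \<open>q\<close>, one compares two centres
      through \<open>x\<close>, and one places a neighbourhood of \<open>q\<close> inside
      \<open>V m x\<close>.\<close>
    define r where "r = Suc (max m j)"
    obtain W where W: "openin X W" "x \<in> W" "W \<subseteq> V (Suc (Suc r)) x" using nbhd[OF x] by blast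
    have near: "q \<in> V (Suc r) x" if "q \<in> D i" "F q \<inter> W \<noteq> {}" for q i
    proof -
      have q: "q \<in> topspace X" using that D_X by blast
      obtain y where y: "y \<in> F q" "y \<in> W" using \<open>F q \<inter> W \<noteq> {}\<close> by blast
      \<comment> \<open>Points of \<open>F q\<close> lie in the class \<open>C q\<close>, hence are
        close to \<open>q\<close> at every scale.\<close>
      have "y \<in> V (Suc (Suc r)) q" using y F[OF q] by (auto simp: C_def)
      then have "q \<in> V (Suc (Suc r)) y" using sym q by blast
      moreover have "y \<in> V (Suc (Suc r)) x" using W y by blast
      ultimately show ?thesis using comp[OF x, of y "Suc r" q] by blast
    qed
    \<comment> \<open>A centre of a stage after \<open>j\<close> whose finite set meets
      \<open>W\<close> would itself be absorbed at stage \<open>j\<close>, yet centres avoid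
      everything absorbed earlier.\<close>
    have late: "F q \<inter> W = {}" if q: "q \<in> D i" "j < i" for q i
    proof (rule ccontr)
      assume "F q \<inter> W \<noteq> {}"
      then have "q \<in> V (Suc (max m j)) x"
        using near[OF q(1)] \<open>F q \<inter> W \<noteq> {}\<close> V_Suc[OF x, of r] unfolding r_def by blast
      then have "V (Suc (max m j)) q \<subseteq> V (max m j) x" using comp x by blast
      also have "\<dots> \<subseteq> V j p" using V_mono[OF x, of m "max m j"] p by auto
      finally have "q \<in> I j (D j)" using p q D_X by (auto simp: I_def)
      then show False using B_mono[OF q(2)] D_sub q by blast
    qed
    \<comment> \<open>Two centres of one stage \<open>i \<le> j\<close> that are both near
      \<open>x\<close> would be \<open>V r\<close>-close, and \<open>r \<ge> Suc i\<close>
      contradicts their separation.\<close>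
    have unique: "q = q'" if q: "q \<in> D i" "q' \<in> D i" "i \<le> j" and ne: "F q \<inter> W \<noteq> {}" "F q' \<inter> W \<noteq> {}" for q q' i
    proof -
      have qX: "q \<in> topspace X" using q D_X by blast
      have "q \<in> V (Suc r) x" "q' \<in> V (Suc r) x" using near q ne by blast+
      then have "q' \<in> V (r) q" using comp[OF qX, of x r q'] sym[OF x] by blast
      then have "q' \<in> V (Suc i) q" using V_mono[OF qX, of "Suc i" r] q(3) max.coboundedI2[of i j m] unfolding r_def by blast
      then show ?thesis using D_sep[of i] q unfolding pairwise_def by blast
    qed
    have "finite {q \<in> D i. F q \<inter> W \<noteq> {}}" if "i \<le> j" for i
    proof (cases "{q \<in> D i. F q \<inter> W \<noteq> {}} = {}")
      case False
      then obtain q where "q \<in> D i" "F q \<inter> W \<noteq> {}" by blast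
      then have "{q \<in> D i. F q \<inter> W \<noteq> {}} \<subseteq> {q}" using unique that by blast
      then show ?thesis using finite_subset by blast
    qed (simp only: finite.emptyI)
    then have "finite (\<Union>i\<le>j. \<Union>q\<in>{q \<in> D i. F q \<inter> W \<noteq> {}}. F q)"
      using F D_X by (intro finite_UN_I) auto
    moreover have "E \<inter> W \<subseteq> (\<Union>i\<le>j. \<Union>q\<in>{q \<in> D i. F q \<inter> W \<noteq> {}}. F q)"
    proof
      fix y assume "y \<in> E \<inter> W"
      then obtain i q where "q \<in> D i" "y \<in> F q" "y \<in> W" by (auto simp: E_def)
      moreover from this have "i \<le> j" using late[of q i] by (meson disjoint_iff not_le)
      ultimately show "y \<in> (\<Union>i\<le>j. \<Union>q\<in>{q \<in> D i. F q \<inter> W \<noteq> {}}. F q)" by blast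
    qed
    ultimately show ?thesis using W finite_subset by blast
  qed
  note E = locally_finite_points_closed_discrete[OF t1 E_X this]
  have "x \<in> (\<Union>y\<in>E. N y)" if x: "x \<in> topspace X" for x
  proof -
    obtain j p m where p: "p \<in> D j" "V m x \<subseteq> V j p" using cover[OF x] by (auto simp: I_def)
    then have "p \<in> topspace X" "k p \<le> j" using D_sub by auto
    then have "x \<in> V (k p) p" using p refl[OF x] V_mono[of p "k p" j] by blast
    then show ?thesis using F[OF \<open>p \<in> topspace X\<close>] p(1) unfolding E_def by blast
  qed
  moreover have "N y \<subseteq> topspace X" if "y \<in> E" for y using N E_X that openin_subset by blast
  ultimately have "topspace X = (\<Union>y\<in>E. N y)" by blast
  with E show "\<exists>D. closedin X D \<and> subtopology X D = discrete_topology D \<and> topspace X = (\<Union>x\<in>D. N x)"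
    by blast
qed

section \<open>Cancellation laws and gyration identities\<close>

context gyrogroup
begin

lemma gyr_closed: "\<lbrakk>x \<in> G; y \<in> G; z \<in> G\<rbrakk> \<Longrightarrow> gyr x y z \<in> G"
  using gyr_bij bij_betwE by blast

lemma neg_neg: "x \<in> G \<Longrightarrow> \<ominus> (\<ominus> x) = x"
  using neg_unique[of "\<ominus> x" x] neg_closed neg_left neg_right by simp

lemma neg_add_cancel_gyr:
  assumes "x \<in> G" "z \<in> G"
  shows "\<ominus> x \<oplus> (x \<oplus> z) = gyr (\<ominus> x) x z"
  using gyr_assoc[of "\<ominus> x" x z] assms neg_closed neg_left zero_left gyr_closed by simp

lemma add_left_cancel:
  assumes "x \<in> G" "a \<in> G" "b \<in> G" "x \<oplus> a = x \<oplus> b"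
  shows "a = b"
proof -
  have "gyr (\<ominus> x) x a = gyr (\<ominus> x) x b"
    using assms neg_add_cancel_gyr by metis
  then show ?thesis
    using gyr_bij[of "\<ominus> x" x] assms neg_closed by (meson bij_betw_imp_inj_on inj_onD)
qed

text \<open>The loop property (G4) identifies \<open>gyr (\<ominus> x) x\<close> with
  \<open>gyr \<zero> x\<close>, and the latter is the identity by left cancellation.\<close>

lemma neg_add_cancel:
  assumes "x \<in> G" "z \<in> G"
  shows "\<ominus> x \<oplus> (x \<oplus> z) = z"
proof -
  have "x \<oplus> gyr \<zero> x z = x \<oplus> z"
    using gyr_assoc[of \<zero> x z] assms zero_closed zero_left add_closed by simp
  then have "gyr \<zero> x z = z"
    using add_left_cancel assms gyr_closed zero_closed by blast
  moreover have "gyr \<zero> x z = gyr (\<ominus> x) x z"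
    using gyr_loop[of "\<ominus> x" x z] assms neg_closed neg_left by simp
  ultimately show ?thesis using neg_add_cancel_gyr assms by simp
qed

lemma add_neg_cancel:
  assumes "x \<in> G" "z \<in> G"
  shows "x \<oplus> (\<ominus> x \<oplus> z) = z"
  using neg_add_cancel[of "\<ominus> x" z] assms neg_neg neg_closed by simp

text \<open>Left cancellation makes a right inverse alone sufficient, whereas
  \<open>neg_unique\<close> asks for both sides.\<close>

lemma eq_neg_if_add_eq_zero:
  assumes "x \<in> G" "y \<in> G" "x \<oplus> y = \<zero>"
  shows "y = \<ominus> x"
  using assms add_left_cancel[of x y "\<ominus> x"] neg_closed neg_right by simp

lemma neg_zero: "\<ominus> \<zero> = \<zero>"
  using eq_neg_if_add_eq_zero zero_closed zero_left by metis

lemma gyr_zero: "\<lbrakk>x \<in> G; y \<in> G\<rbrakk> \<Longrightarrow> gyr x y \<zero> = \<zero>"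
  by (metis add_left_cancel gyr_closed gyr_hom zero_closed zero_right)

lemma gyr_neg:
  assumes "x \<in> G" "y \<in> G" "z \<in> G"
  shows "gyr x y (\<ominus> z) = \<ominus> gyr x y z"
  using assms eq_neg_if_add_eq_zero gyr_closed gyr_hom gyr_zero neg_closed neg_right by metis

text \<open>This plays the role of the triangle inequality: up to a gyration, the difference from
  \<open>x\<close> to \<open>z\<close> is the sum of those from \<open>x\<close> to \<open>y\<close>
  and from \<open>y\<close> to \<open>z\<close>.\<close>

lemma neg_add_triangle:
  assumes "x \<in> G" "y \<in> G" "z \<in> G"
  shows "\<ominus> x \<oplus> z = (\<ominus> x \<oplus> y) \<oplus> gyr (\<ominus> x) y (\<ominus> y \<oplus> z)"
  using gyr_assoc[of "\<ominus> x" y "\<ominus> y \<oplus> z"] assms neg_closed add_closed add_neg_cancel by simp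

text \<open>The case \<open>z = x\<close> of the triangle identity has sum \<open>\<zero>\<close>.
  It serves to exchange \<open>x\<close> and \<open>y\<close> in a difference, at the price of a
  gyration and an inverse.\<close>

lemma gyr_neg_add_swap:
  assumes "x \<in> G" "y \<in> G"
  shows "gyr (\<ominus> x) y (\<ominus> y \<oplus> x) = \<ominus> (\<ominus> x \<oplus> y)"
  using neg_add_triangle[of x y x] assms neg_closed add_closed neg_left gyr_closed
  by (metis eq_neg_if_add_eq_zero)

end

section \<open>Left translations as homeomorphisms\<close>

context topological_gyrogroup
begin

lemma left_translation_continuous:
  assumes "x \<in> G"
  shows "continuous_map T T (\<lambda>y. x \<oplus> y)"
proof -
  have "continuous_map T (prod_topology T T) (\<lambda>y. (x, y))"
    using assms topspace_eq by (simp add: continuous_map_pairedI)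
  from continuous_map_compose[OF this add_continuous] show ?thesis by (simp add: o_def)
qed

lemma openin_translation_vimage:
  assumes "x \<in> G" "openin T W"
  shows "openin T {y \<in> G. x \<oplus> y \<in> W}"
  using openin_continuous_map_preimage[OF left_translation_continuous[OF assms(1)] assms(2)] topspace_eq by simp

text \<open>Translation by \<open>\<ominus> x\<close> inverts translation by \<open>x\<close>.
  Writing images as preimages lets continuity yield openness of translates.\<close>

lemma translate_eq_vimage:
  assumes "x \<in> G" "A \<subseteq> G"
  shows "(\<lambda>y. x \<oplus> y) ` A = {y \<in> G. \<ominus> x \<oplus> y \<in> A}"
proof (intro equalityI subsetI)
  fix y assume "y \<in> {y \<in> G. \<ominus> x \<oplus> y \<in> A}"
  then show "y \<in> (\<lambda>y. x \<oplus> y) ` A"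
    using assms add_neg_cancel[of x y] by (intro image_eqI[of _ _ "\<ominus> x \<oplus> y"]) auto
next
  fix y assume "y \<in> (\<lambda>y. x \<oplus> y) ` A"
  then show "y \<in> {y \<in> G. \<ominus> x \<oplus> y \<in> A}"
    using assms neg_add_cancel add_closed by auto
qed

lemma compactin_translate:
  assumes "x \<in> G" "compactin T A"
  shows "compactin T ((\<lambda>y. x \<oplus> y) ` A)"
  using image_compactin assms left_translation_continuous by blast

lemma openin_translate:
  assumes "x \<in> G" "openin T A"
  shows "openin T ((\<lambda>y. x \<oplus> y) ` A)"
  using translate_eq_vimage[OF assms(1), of A] openin_translation_vimage[of "\<ominus> x" A]
    assms neg_closed openin_subset topspace_eq by metis

lemma base_at_translate:
  assumes x: "x \<in> G" and b: "base_at T F \<gamma>" and F: "F \<subseteq> G"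
  shows "base_at T ((\<lambda>y. x \<oplus> y) ` F) ((\<lambda>A. (\<lambda>y. x \<oplus> y) ` A) ` \<gamma>)"
  unfolding base_at_def
proof (intro conjI ballI allI impI)
  fix U assume "U \<in> (\<lambda>A. (\<lambda>y. x \<oplus> y) ` A) ` \<gamma>"
  then show "openin T U" "(\<lambda>y. x \<oplus> y) ` F \<subseteq> U"
    using b openin_translate[OF x] by (auto simp: base_at_def)
next
  fix W assume W: "openin T W \<and> (\<lambda>y. x \<oplus> y) ` F \<subseteq> W"
  then have "openin T {y \<in> G. x \<oplus> y \<in> W}" "F \<subseteq> {y \<in> G. x \<oplus> y \<in> W}"
    using openin_translation_vimage x F by auto
  then obtain U where "U \<in> \<gamma>" "U \<subseteq> {y \<in> G. x \<oplus> y \<in> W}" using b unfolding base_at_def by meson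
  then show "\<exists>U\<in>(\<lambda>A. (\<lambda>y. x \<oplus> y) ` A) ` \<gamma>. U \<subseteq> W" by blast
qed

text \<open>Translating the compact set by \<open>\<ominus> k\<close> for one of its points
  \<open>k\<close> moves \<open>k\<close> to \<open>\<zero>\<close> and keeps a countable
  base.\<close>

lemma feathered_at_zero:
  assumes "feathered T"
  obtains K \<gamma> where "compactin T K" "\<zero> \<in> K" "base_at T K \<gamma>" "countable \<gamma>"
proof -
  obtain K \<gamma> where K: "K \<noteq> {}" "compactin T K" "base_at T K \<gamma>" "countable \<gamma>"
    using assms character_at_countable_iff unfolding feathered_def by metis
  then obtain k where k: "k \<in> K" by blast
  have KG: "K \<subseteq> G" using K(2) compactin_subset_topspace topspace_eq by blast
  have "\<zero> = \<ominus> k \<oplus> k" using neg_left k KG by auto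
  then have "\<zero> \<in> (\<lambda>y. \<ominus> k \<oplus> y) ` K" using k by (rule image_eqI)
  then show ?thesis
    using that[OF compactin_translate[OF _ K(2)] _ base_at_translate[OF _ K(3) KG]] K(4) neg_closed k KG
    by blast
qed

end

section \<open>Invariant neighbourhoods of zero\<close>

context strongly_topological_gyrogroup
begin

definition invariant_nbhd :: "'a set \<Rightarrow> bool" where
  "invariant_nbhd U \<longleftrightarrow> U \<subseteq> G \<and> (\<exists>W. openin T W \<and> \<zero> \<in> W \<and> W \<subseteq> U) \<and>
     (\<forall>z\<in>U. \<ominus> z \<in> U) \<and> (\<forall>x\<in>G. \<forall>y\<in>G. \<forall>z\<in>U. gyr x y z \<in> U)"

text \<open>Continuity of \<open>\<oplus>\<close> at \<open>(\<zero>, \<zero>)\<close> gives a small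
  member \<open>U\<close> of the invariant base. Keeping only the points whose inverse also lies in
  \<open>U\<close> makes it symmetric, and preserves invariance because gyrations commute with
  inversion.\<close>

lemma invariant_nbhd_exists:
  assumes A: "openin T A" "\<zero> \<in> A"
  shows "\<exists>U. invariant_nbhd U \<and> (\<forall>a\<in>U. \<forall>b\<in>U. a \<oplus> b \<in> A)"
proof -
  have "openin (prod_topology T T) {p \<in> topspace (prod_topology T T). (case p of (x, y) \<Rightarrow> x \<oplus> y) \<in> A}"
    by (rule openin_continuous_map_preimage[OF add_continuous A(1)])
  moreover have "(\<zero>, \<zero>) \<in> {p \<in> topspace (prod_topology T T). (case p of (x, y) \<Rightarrow> x \<oplus> y) \<in> A}"
    using A zero_closed zero_left topspace_eq by simp
  ultimately obtain P Q where PQ: "openin T P" "openin T Q" "\<zero> \<in> P" "\<zero> \<in> Q"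
    "P \<times> Q \<subseteq> {p \<in> topspace (prod_topology T T). (case p of (x, y) \<Rightarrow> x \<oplus> y) \<in> A}"
    unfolding openin_prod_topology_alt by meson
  obtain \<U> where \<U>: "nhd_base T \<zero> \<U>" "\<forall>U\<in>\<U>. \<forall>x\<in>G. \<forall>y\<in>G. gyr x y ` U = U"
    using gyr_invariant_base by (elim exE conjE)
  have "openin T (P \<inter> Q)" "\<zero> \<in> P \<inter> Q" using PQ by auto
  then obtain U where U: "U \<in> \<U>" "U \<subseteq> P \<inter> Q" using \<U>(1) unfolding nhd_base_def by meson
  then obtain W where W: "openin T W" "\<zero> \<in> W" "W \<subseteq> U" "U \<subseteq> G"
    using \<U>(1) topspace_eq unfolding nhd_base_def by meson
  have gU: "gyr x y z \<in> U" if "x \<in> G" "y \<in> G" "z \<in> U" for x y z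
  proof -
    have "gyr x y ` U = U" using \<U>(2) U(1) that(1,2) by simp
    then show ?thesis using that(3) by (metis imageI)
  qed
  let ?U = "{z \<in> U. \<ominus> z \<in> U}"
  have "invariant_nbhd ?U"
    unfolding invariant_nbhd_def
  proof (intro conjI ballI)
    show "?U \<subseteq> G" using W by blast
    have "openin T {z \<in> topspace T. \<ominus> z \<in> W}"
      by (rule openin_continuous_map_preimage[OF neg_continuous W(1)])
    then have "openin T (W \<inter> {z \<in> topspace T. \<ominus> z \<in> W})" using W by blast
    moreover have "\<zero> \<in> W \<inter> {z \<in> topspace T. \<ominus> z \<in> W}" using W zero_closed neg_zero topspace_eq by simp
    ultimately show "\<exists>W. openin T W \<and> \<zero> \<in> W \<and> W \<subseteq> ?U" using W by blast
  next
    fix z assume "z \<in> ?U"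
    then show "\<ominus> z \<in> ?U" using neg_neg W by auto
  next
    fix x y z assume "x \<in> G" "y \<in> G" "z \<in> ?U"
    moreover from this have "\<ominus> gyr x y z = gyr x y (\<ominus> z)" using gyr_neg[of x y z] W by auto
    ultimately show "gyr x y z \<in> ?U" using gU by simp
  qed
  moreover have "a \<oplus> b \<in> A" if "a \<in> ?U" "b \<in> ?U" for a b
  proof -
    have "(a, b) \<in> P \<times> Q" using that U(2) by blast
    from subsetD[OF PQ(5) this] show ?thesis by simp
  qed
  ultimately show ?thesis by blast
qed

lemma feathered_invariant_sequence:
  assumes "feathered T"
  obtains U where "\<And>n. invariant_nbhd (U n)"
    "\<And>n a b. \<lbrakk>a \<in> U (Suc n); b \<in> U (Suc n)\<rbrakk> \<Longrightarrow> a \<oplus> b \<in> U n"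
    "compactin T (\<Inter>n. U n)"
    "\<And>W. \<lbrakk>openin T W; (\<Inter>n. U n) \<subseteq> W\<rbrakk> \<Longrightarrow> \<exists>n. U n \<subseteq> W"
proof -
  obtain K \<gamma> where K: "compactin T K" "\<zero> \<in> K" "base_at T K \<gamma>" "countable \<gamma>"
    using assms by (rule feathered_at_zero)
  have KG: "K \<subseteq> G" using K(1) compactin_subset_topspace topspace_eq by blast
  have "\<gamma> \<noteq> {}" using K(3) KG openin_topspace[of T] topspace_eq unfolding base_at_def by blast
  then obtain A :: "nat \<Rightarrow> 'a set" where A: "range A = \<gamma>"
    using range_from_nat_into[OF _ K(4)] by auto
  have "A n \<in> \<gamma>" for n unfolding A[symmetric] by (rule rangeI)
  then have A_open: "openin T (A n)" and A_K: "K \<subseteq> A n" for n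
    using K(3) by (simp_all add: base_at_def)
  have A_base: "\<exists>n. A n \<subseteq> W" if W: "openin T W" "K \<subseteq> W" for W
  proof -
    obtain Q where "Q \<in> \<gamma>" "Q \<subseteq> W" using K(3) W unfolding base_at_def by meson
    then show ?thesis using A[symmetric] by auto
  qed
  have step: "\<exists>U'. invariant_nbhd U' \<and> U' \<subseteq> A n \<and> (\<forall>a\<in>U'. \<forall>b\<in>U'. a \<oplus> b \<in> U)" if U: "invariant_nbhd U" for U n
  proof -
    obtain W where W: "openin T W" "\<zero> \<in> W" "W \<subseteq> U" using U unfolding invariant_nbhd_def by blast
    then have "openin T (W \<inter> A n)" "\<zero> \<in> W \<inter> A n" using A_open A_K K by auto
    from invariant_nbhd_exists[OF this] obtain U' where U': "invariant_nbhd U'" "\<forall>a\<in>U'. \<forall>b\<in>U'. a \<oplus> b \<in> W \<inter> A n"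
      by blast
    have "\<zero> \<in> U'" "U' \<subseteq> G" using U' unfolding invariant_nbhd_def by auto
    \<comment> \<open>Since \<open>\<zero> \<in> U'\<close>, each element of \<open>U'\<close> is
      the sum of itself and \<open>\<zero>\<close>.\<close>
    then have "U' \<subseteq> A n" using U'(2) zero_right by (metis IntD2 subsetD subsetI)
    then show ?thesis using U' W by blast
  qed
  obtain U0 where "invariant_nbhd U0"
    using invariant_nbhd_exists[of "topspace T"] zero_closed topspace_eq openin_topspace by metis
  with step obtain U where U: "\<And>n. invariant_nbhd (U n)" "\<And>n. U (Suc n) \<subseteq> A n"
    "\<And>n a b. \<lbrakk>a \<in> U (Suc n); b \<in> U (Suc n)\<rbrakk> \<Longrightarrow> a \<oplus> b \<in> U n"
    using dependent_nat_choice[of "\<lambda>_ U. invariant_nbhd U"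
        "\<lambda>n U U'. U' \<subseteq> A n \<and> (\<forall>a\<in>U'. \<forall>b\<in>U'. a \<oplus> b \<in> U)"] by metis
  have U0: "\<zero> \<in> U n" and UG: "U n \<subseteq> G" and Uneg: "\<And>z. z \<in> U n \<Longrightarrow> \<ominus> z \<in> U n"
    and Ugyr: "\<And>x y z. \<lbrakk>x \<in> G; y \<in> G; z \<in> U n\<rbrakk> \<Longrightarrow> gyr x y z \<in> U n"
    and Unbhd: "\<exists>W. openin T W \<and> \<zero> \<in> W \<and> W \<subseteq> U n" for n
    using U(1)[of n] unfolding invariant_nbhd_def by blast+
  have "U (Suc n) \<subseteq> U n" for n
  proof
    fix a assume "a \<in> U (Suc n)"
    then show "a \<in> U n" using U(3)[of a n \<zero>] U0 UG[of "Suc n"] zero_right by auto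
  qed
  then have U_mono: "U m \<subseteq> U n" if "n \<le> m" for n m
    using lift_Suc_antimono_le[of U] that by blast
  \<comment> \<open>The neighbourhood \<open>z \<oplus> W\<close> of \<open>z\<close> meets
    \<open>U (Suc n)\<close> in some \<open>u = z \<oplus> w\<close>. Invariance and symmetry turn
    \<open>w = \<ominus> z \<oplus> u\<close> into
    \<open>\<ominus> u \<oplus> z \<in> U (Suc n)\<close>, and then
    \<open>z = u \<oplus> (\<ominus> u \<oplus> z)\<close>.\<close>
  have cl: "T closure_of U (Suc n) \<subseteq> U n" for n
  proof
    fix z assume z: "z \<in> T closure_of U (Suc n)"
    then have zG: "z \<in> G" using in_closure_of topspace_eq by fastforce
    obtain W where W: "openin T W" "\<zero> \<in> W" "W \<subseteq> U (Suc n)" using Unbhd by blast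
    have "openin T ((\<lambda>y. z \<oplus> y) ` W)" using openin_translate zG W by blast
    moreover have "z \<in> (\<lambda>y. z \<oplus> y) ` W" using W zero_right zG by (metis image_eqI)
    ultimately obtain u where u: "u \<in> U (Suc n)" "u \<in> (\<lambda>y. z \<oplus> y) ` W"
      using z unfolding in_closure_of by blast
    then obtain w where w: "w \<in> U (Suc n)" "u = z \<oplus> w" using W by blast
    have G: "u \<in> G" "w \<in> G" using u w UG by auto
    have "\<ominus> z \<oplus> u = w" using w G zG neg_add_cancel by simp
    then have "gyr (\<ominus> u) z w = \<ominus> (\<ominus> u \<oplus> z)" using gyr_neg_add_swap[of u z] G zG by simp
    then have "\<ominus> (\<ominus> u \<oplus> z) \<in> U (Suc n)" using Ugyr[of "\<ominus> u" z w "Suc n"] w G zG neg_closed by simp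
    then have "\<ominus> u \<oplus> z \<in> U (Suc n)"
      using Uneg[of "\<ominus> (\<ominus> u \<oplus> z)"] neg_neg add_closed neg_closed G zG by metis
    then have "u \<oplus> (\<ominus> u \<oplus> z) \<in> U n" using U(3) u by blast
    then show "z \<in> U n" using add_neg_cancel G zG by simp
  qed
  let ?H = "\<Inter>n. U n"
  have H_cl: "?H = (\<Inter>n. T closure_of U n)"
  proof
    have "U n \<subseteq> T closure_of U n" for n using closure_of_subset UG topspace_eq by metis
    then show "?H \<subseteq> (\<Inter>n. T closure_of U n)" by blast
    show "(\<Inter>n. T closure_of U n) \<subseteq> ?H" using cl by blast
  qed
  have "?H \<subseteq> K"
  proof
    fix y assume y: "y \<in> ?H"
    show "y \<in> K"
    proof (rule ccontr)
      assume "y \<notin> K"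
      have "closedin T {y}" using T1 UG y topspace_eq by (simp add: closedin_t1_singleton subset_iff)
      then have "openin T (topspace T - {y})" by blast
      moreover have "K \<subseteq> topspace T - {y}" using \<open>y \<notin> K\<close> KG topspace_eq by blast
      ultimately obtain n where "A n \<subseteq> topspace T - {y}" using A_base by blast
      then show False using U(2)[of n] y by blast
    qed
  qed
  moreover have "closedin T ?H" unfolding H_cl by (intro closedin_Inter) auto
  ultimately have H_cpt: "compactin T ?H" using K(1) closed_compactin by blast
  \<comment> \<open>The open set \<open>W\<close> and the increasing complements of the closures
    cover \<open>K\<close>, so by compactness \<open>W\<close> and a single complement suffice. Some
    \<open>A m\<close> lies in their union, and a late \<open>U\<close> lies in \<open>A m\<close>
    but misses the complement.\<close>
  have H_base: "\<exists>n. U n \<subseteq> W" if W: "openin T W" "?H \<subseteq> W" for W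
  proof -
    let ?O = "\<lambda>n. topspace T - T closure_of U n"
    have O_mono: "?O m \<subseteq> ?O n" if "m \<le> n" for m n
      using closure_of_mono[OF U_mono[OF that]] by blast
    have "K \<subseteq> W \<union> (\<Union>n. ?O n)" using W H_cl KG topspace_eq by blast
    then have "K \<subseteq> \<Union>(insert W (range ?O))" by simp
    moreover have "\<forall>Q\<in>insert W (range ?O). openin T Q" using W by auto
    ultimately obtain \<F> where \<F>: "finite \<F>" "\<F> \<subseteq> insert W (range ?O)" "K \<subseteq> \<Union>\<F>"
      using K(1) unfolding compactin_def by meson
    then have "finite (\<F> - {W})" "\<F> - {W} \<subseteq> range ?O" by auto
    then obtain J where J: "finite J" "\<F> - {W} = ?O ` J" by (metis finite_subset_image)
    \<comment> \<open>The extra \<open>0\<close> keeps the maximum defined when \<open>W\<close>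
      alone covers \<open>K\<close>.\<close>
    define n where "n = Max (insert 0 J)"
    have "?O i \<subseteq> ?O n" if "i \<in> J" for i using J that by (intro O_mono) (auto simp: n_def)
    then have "\<Union>(\<F> - {W}) \<subseteq> ?O n" unfolding J by blast
    then have "K \<subseteq> W \<union> ?O n" using \<F>(3) by blast
    moreover have "openin T (W \<union> ?O n)"
      using W(1) by (intro openin_Un openin_diff openin_topspace closedin_closure_of)
    ultimately obtain m where m: "A m \<subseteq> W \<union> ?O n" using A_base by blast
    have "U (max (Suc m) n) \<subseteq> A m" using U(2)[of m] U_mono[of "Suc m" "max (Suc m) n"] by auto
    moreover have "U (max (Suc m) n) \<subseteq> T closure_of U n"
      using U_mono[of n "max (Suc m) n"] closure_of_subset[of "U n" T] UG topspace_eq by fastforce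
    ultimately show ?thesis using m by blast
  qed
  show ?thesis using that[OF U(1) U(3) H_cpt H_base] by blast
qed

section \<open>The uniformity of left translates\<close>

lemma feathered_imp_D_space:
  assumes "feathered T"
  shows "D_space T"
proof -
  obtain U where U: "\<And>n. invariant_nbhd (U n)"
    and Uadd: "\<And>n a b. \<lbrakk>a \<in> U (Suc n); b \<in> U (Suc n)\<rbrakk> \<Longrightarrow> a \<oplus> b \<in> U n"
    and cpt: "compactin T (\<Inter>n. U n)"
    and base: "\<And>W. \<lbrakk>openin T W; (\<Inter>n. U n) \<subseteq> W\<rbrakk> \<Longrightarrow> \<exists>n. U n \<subseteq> W"
    using assms by (rule feathered_invariant_sequence) blast
  have U0: "\<zero> \<in> U n" and UG: "U n \<subseteq> G" and Uneg: "\<And>z. z \<in> U n \<Longrightarrow> \<ominus> z \<in> U n"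
    and Ugyr: "\<And>x y z. \<lbrakk>x \<in> G; y \<in> G; z \<in> U n\<rbrakk> \<Longrightarrow> gyr x y z \<in> U n"
    and Unbhd: "\<exists>W. openin T W \<and> \<zero> \<in> W \<and> W \<subseteq> U n" for n
    using U[of n] unfolding invariant_nbhd_def by blast+
  \<comment> \<open>The description by differences suits symmetry and composition; the equivalent
    one as a translate of \<open>U n\<close> suits the topological conditions.\<close>
  define V where "V n x = {y \<in> G. \<ominus> x \<oplus> y \<in> U n}" for n x
  have V_eq: "V n x = (\<lambda>y. x \<oplus> y) ` U n" if "x \<in> G" for n x
    using translate_eq_vimage that UG unfolding V_def by blast
  have C_eq: "(\<Inter>n. V n x) = (\<lambda>y. x \<oplus> y) ` (\<Inter>n. U n)" if "x \<in> G" for x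
    using translate_eq_vimage[OF that, of "\<Inter>n. U n"] UG unfolding V_def by blast
  show ?thesis
  proof (rule D_space_if_perfect_entourages[of T V])
    fix n x assume x: "x \<in> topspace T"
    then have xG: "x \<in> G" using topspace_eq by simp
    show "x \<in> V n x" using xG U0 neg_left by (simp add: V_def)
    show "V n x \<subseteq> topspace T" using topspace_eq by (auto simp: V_def)
    show "x \<in> V n y" if "y \<in> V n x" for y
    proof -
      have y: "y \<in> G" "\<ominus> x \<oplus> y \<in> U n" using that by (auto simp: V_def)
      \<comment> \<open>This element is the image of \<open>\<ominus> x \<oplus> y\<close> under
        \<open>gyr (\<ominus> y) x\<close>, so invariance applies.\<close>
      then have "\<ominus> (\<ominus> y \<oplus> x) \<in> U n"
        using gyr_neg_add_swap[of y x] Ugyr[of "\<ominus> y" x] xG neg_closed by metis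
      then show ?thesis
        using Uneg[of "\<ominus> (\<ominus> y \<oplus> x)"] neg_neg add_closed neg_closed y xG unfolding V_def by simp
    qed
    \<comment> \<open>In the triangle identity the gyrated summand stays in \<open>U (Suc n)\<close>
      by invariance.\<close>
    show "z \<in> V n x" if "y \<in> V (Suc n) x" "z \<in> V (Suc n) y" for y z
      using that neg_add_triangle[of x y z] Uadd Ugyr[of "\<ominus> x" y] xG neg_closed by (simp add: V_def)
    show "\<exists>W. openin T W \<and> x \<in> W \<and> W \<subseteq> V n x"
    proof -
      obtain W where W: "openin T W" "\<zero> \<in> W" "W \<subseteq> U n" using Unbhd by blast
      then have "x \<in> (\<lambda>y. x \<oplus> y) ` W" using zero_right xG by (metis image_eqI)
      then show ?thesis using W openin_translate[OF xG W(1)] V_eq[OF xG] by blast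
    qed
    show "compactin T (\<Inter>n. V n x)" unfolding C_eq[OF xG] using compactin_translate[OF xG cpt] .
    show "\<exists>n. V n x \<subseteq> W" if W: "openin T W" "(\<Inter>n. V n x) \<subseteq> W" for W
    proof -
      have "(\<Inter>n. U n) \<subseteq> {y \<in> G. x \<oplus> y \<in> W}" using W(2) UG unfolding C_eq[OF xG] by blast
      then obtain n where "U n \<subseteq> {y \<in> G. x \<oplus> y \<in> W}"
        using base openin_translation_vimage[OF xG W(1)] by blast
      then have "V n x \<subseteq> W" unfolding V_eq[OF xG] by blast
      then show ?thesis ..
    qed
  qed (rule T1)
qed

end

theorem corollary3p16:
  fixes G :: "'a set" and T :: "'a topology"
    and gadd :: "'a \<Rightarrow> 'a \<Rightarrow> 'a" and gzero :: 'a and gneg :: "'a \<Rightarrow> 'a"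
    and gyr :: "'a \<Rightarrow> 'a \<Rightarrow> 'a \<Rightarrow> 'a"
  assumes "strongly_topological_gyrogroup G T gadd gzero gneg gyr"
    and "feathered T"
  shows "D_space T"
  using assms by (rule strongly_topological_gyrogroup.feathered_imp_D_space)

end
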